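(* There exist two positive constants $c_1$ and $c_2$ such that for any positive integer $k$, $$c_1\frac{1}{k}\binom{2k+1}{k} \le tw(BK(2k+1, k)) \le tw(J(2k+1,k)) \le c_2\binom{2k+1}{k}.$$
   Context: The bipartite Kneser graph $BK(n,k)$ ($n\ge 2k+1$) is the bipartite graph whose two parts are the family of all $k$-subsets of $[n]=\{1,\dots,n\}$ and the family of all $(n-k)$-subsets of $[n]$, a $k$-subset $A$ and an $(n-k)$-subset $B$ being adjacent iff $A\subseteq B$. The Johnson graph $J(n,k)$ has as vertices all $k$-subsets of $[n]$, two being adjacent iff their intersection has exactly $k-1$ elements. $tw(G)$ denotes treewidth. *)

theory Defs
  imports Complex_Main "Graph_Theory.Graph_Theory"
begin

text \<open>
  A finite simple graph is a \<open>pair_graph\<close>: every edge is represented by both of its orientations.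
\<close>

definition ksubsets :: "nat \<Rightarrow> nat \<Rightarrow> nat set set" where
  "ksubsets n k = {A. A \<subseteq> {1..n} \<and> card A = k}"

text \<open>
  The two parts are disjoint as soon as \<open>n \<noteq> 2 * k\<close>, so they need no tags.
\<close>

definition bipartite_kneser :: "nat \<Rightarrow> nat \<Rightarrow> nat set pair_pre_digraph" where
  "bipartite_kneser n k =
    \<lparr> pverts = ksubsets n k \<union> ksubsets n (n - k),
      parcs = {(A, B). A \<in> ksubsets n k \<and> B \<in> ksubsets n (n - k) \<and> A \<subseteq> B}
            \<union> {(B, A). A \<in> ksubsets n k \<and> B \<in> ksubsets n (n - k) \<and> A \<subseteq> B} \<rparr>"

definition johnson :: "nat \<Rightarrow> nat \<Rightarrow> nat set pair_pre_digraph" where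
  "johnson n k =
    \<lparr> pverts = ksubsets n k,
      parcs = {(A, B). A \<in> ksubsets n k \<and> B \<in> ksubsets n k \<and> card (A \<inter> B) + 1 = k} \<rparr>"

text \<open>
  The predicate \<open>tree\<close> of \<open>Digraph_Component\<close> is not usable here: its notion of cycle is the
  directed one, so in a symmetric digraph every edge already gives a cycle \<open>u, v, u\<close>.  In a
  \<open>pair_graph\<close> the undirected cycles are the directed cycles of length at least 3.
  Connectedness includes having at least one vertex.
\<close>

definition undirected_tree :: "'t pair_pre_digraph \<Rightarrow> bool" where
  "undirected_tree T \<longleftrightarrow>
    pair_graph T \<and> Digraph_Component.connected (with_proj T) \<and>
    \<not> (\<exists>p. pre_digraph.cycle (with_proj T) p \<and> 3 \<le> length p)"

definition tree_decomposition ::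
  "'a pair_pre_digraph \<Rightarrow> 't pair_pre_digraph \<Rightarrow> ('t \<Rightarrow> 'a set) \<Rightarrow> bool" where
  "tree_decomposition G T X \<longleftrightarrow>
    undirected_tree T \<and>
    (\<Union>t\<in>pverts T. X t) = pverts G \<and>
    (\<forall>(u, v)\<in>parcs G. \<exists>t\<in>pverts T. u \<in> X t \<and> v \<in> X t) \<and>
    (\<forall>v\<in>pverts G. Digraph_Component.connected (with_proj T \<restriction> {t \<in> pverts T. v \<in> X t}))"

text \<open>
  The truncated subtraction only matters for the graph without vertices, all of whose bags are
  empty.
\<close>

definition decomposition_width :: "'t pair_pre_digraph \<Rightarrow> ('t \<Rightarrow> 'a set) \<Rightarrow> nat" where
  "decomposition_width T X = Max ((\<lambda>t. card (X t)) ` pverts T) - 1"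

text \<open>
  The trees are finite, so natural numbers suffice as their nodes.
\<close>

definition treewidth :: "'a pair_pre_digraph \<Rightarrow> nat" where
  "treewidth G =
    (LEAST w. \<exists>(T :: nat pair_pre_digraph) X.
       tree_decomposition G T X \<and> decomposition_width T X = w)"

lemma finite_ksubsets: "finite (ksubsets n k)"
  by (rule finite_subset[of _ "Pow {1..n}"]) (auto simp: ksubsets_def)

lemma pair_graph_bipartite_kneser:
  assumes "2 * k + 1 \<le> n"
  shows "pair_graph (bipartite_kneser n k)"
proof unfold_locales
  show "finite (parcs (bipartite_kneser n k))"
    by (rule finite_subset[of _ "(ksubsets n k \<union> ksubsets n (n - k)) \<times> (ksubsets n k \<union> ksubsets n (n - k))"])
       (auto simp: bipartite_kneser_def finite_ksubsets)
  show "symmetric (with_proj (bipartite_kneser n k))"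
    by (auto simp: symmetric_def bipartite_kneser_def sym_def)
qed (use assms in \<open>auto simp: bipartite_kneser_def finite_ksubsets\<close>, auto simp: ksubsets_def)

lemma pair_graph_johnson: "pair_graph (johnson n k)"
proof unfold_locales
  show "finite (parcs (johnson n k))"
    by (rule finite_subset[of _ "ksubsets n k \<times> ksubsets n k"])
       (auto simp: johnson_def finite_ksubsets)
  show "symmetric (with_proj (johnson n k))"
    by (auto simp: symmetric_def johnson_def sym_def Int_commute)
qed (auto simp: johnson_def finite_ksubsets, auto simp: ksubsets_def)

lemma ex_tree_decomposition:
  assumes "pair_graph G"
  shows "\<exists>(T :: nat pair_pre_digraph) X. tree_decomposition G T X"
proof -
  interpret pair_graph G by fact
  let ?T = "\<lparr> pverts = {0::nat}, parcs = {} \<rparr>"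
  have T: "pair_graph ?T"
    by unfold_locales (auto simp: symmetric_def sym_def)
  have conn: "Digraph_Component.connected H" if "verts H = {0::nat}" for H :: "(nat, nat \<times> nat) pre_digraph"
    using that by (auto simp: Digraph_Component.connected_def strongly_connected_def
      mk_symmetric_def reachable_def intro: rtrancl_on_refl)
  have "undirected_tree ?T"
    using T conn[of "with_proj ?T"]
    by (auto simp: undirected_tree_def pre_digraph.cycle_def pre_digraph.awalk_def)
  then have "tree_decomposition G ?T (\<lambda>_. pverts G)"
    by (auto simp: tree_decomposition_def wellformed' intro!: conn)
  then show ?thesis by blast
qed

end

(*
  Lower bound: pairwise touching connected sets are all hit by one bag (Helly property of subtrees),
  so it suffices that deleting a set X of at most tw + 1 vertices leaves a component with more than
  half of the N = (2k+1 choose k) k-subsets, as any two of these components meet.  Two k-subsets are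
  joined by a path with at most 2k + 1 vertices.  Applying all permutations of {1..2k+1} to such a
  path moves each of its vertices uniformly over its layer of size N, so at most a fraction
  (2k+1)|X|/N of all pairs of k-subsets is separated by X.  This gives N <= 2(2k+1)(tw + 1).

  Middle inequality: the k-subsets of a (k+1)-set form a clique of the Johnson graph, hence lie in a
  common bag, to which a leaf with one more vertex can be attached for the (k+1)-set.  Its bag has
  size k + 2, which is the size of a clique of the Johnson graph.
*)

theory Submission
  imports Defs "HOL-Combinatorics.Permutations"
begin

text \<open>The factor 1/k in the lower bound is the price of a union bound: a path with up to 2k +
  1 vertices survives only if none of them falls into X. The averaging rests on the symmetric group,
  which is transitive on each layer; the two layers have equal size because n = 2k + 1. The bramble
  is built against a given decomposition, one set per bag and disjoint from that bag, so a bag that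
  hits all of them contradicts its own choice. The definition of a tree speaks of walks and cycles,
  whereas the Helly property and the attaching of leaves remove or add one vertex at a time; hence
  trees are restated by cuts and leaves.\<close>

section \<open>Connected sets, forests and the Helly property of subtrees\<close>

text \<open>Encoded by cuts instead of paths: to prove a property on all of \<open>S\<close> it is
  enough that the set where it holds is nonempty and left by no edge. Unions, images and changes of
  \<open>E\<close> then need no concatenation of walks.\<close>

definition conn_on :: "'a rel \<Rightarrow> 'a set \<Rightarrow> bool" where
  "conn_on E S \<longleftrightarrow> S \<noteq> {} \<and>
    (\<forall>A. A \<subseteq> S \<longrightarrow> A \<noteq> {} \<longrightarrow> A \<noteq> S \<longrightarrow> (\<exists>x\<in>A. \<exists>y\<in>S - A. (x, y) \<in> E))"

text \<open>Acyclicity is stated through leaves, which is what the inductive proofs consume.\<close>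

definition forest_on :: "'a rel \<Rightarrow> 'a set \<Rightarrow> bool" where
  "forest_on E V \<longleftrightarrow>
    (\<forall>U. U \<subseteq> V \<longrightarrow> U \<noteq> {} \<longrightarrow>
      (\<exists>v\<in>U. \<forall>x\<in>U. \<forall>y\<in>U. (v, x) \<in> E \<longrightarrow> (v, y) \<in> E \<longrightarrow> x = y))"

lemma conn_onD:
  assumes "conn_on E S" "A \<subseteq> S" "x \<in> A" "\<And>x y. x \<in> A \<Longrightarrow> y \<in> S - A \<Longrightarrow> (x, y) \<notin> E"
  shows "A = S"
proof (rule ccontr)
  assume "A \<noteq> S"
  then obtain x y where "x \<in> A" "y \<in> S - A" "(x, y) \<in> E"
    using assms(1-3) unfolding conn_on_def by (metis empty_iff)
  then show False using assms(4) by blast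
qed

lemma conn_onI:
  assumes "S \<noteq> {}"
    and "\<And>A x. A \<subseteq> S \<Longrightarrow> x \<in> A \<Longrightarrow> (\<And>x y. x \<in> A \<Longrightarrow> y \<in> S - A \<Longrightarrow> (x, y) \<notin> E) \<Longrightarrow> S \<subseteq> A"
  shows "conn_on E S"
  unfolding conn_on_def
proof (intro conjI allI impI)
  fix A assume A: "A \<subseteq> S" "A \<noteq> {}" "A \<noteq> S"
  then obtain x where "x \<in> A" by blast
  then show "\<exists>x\<in>A. \<exists>y\<in>S - A. (x, y) \<in> E"
    using assms(2)[of A x] A by (metis subset_antisym)
qed (fact assms(1))

lemma conn_on_singleton: "conn_on E {x}"
  by (rule conn_onI) auto

lemma conn_on_mono:
  assumes "conn_on E S" "E \<inter> S \<times> S \<subseteq> F"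
  shows "conn_on F S"
proof (rule conn_onI)
  fix A x assume A: "A \<subseteq> S" "x \<in> A"
    and cut: "\<And>x y. x \<in> A \<Longrightarrow> y \<in> S - A \<Longrightarrow> (x, y) \<notin> F"
  have "A = S" by (rule conn_onD[OF assms(1) A]) (use A cut assms(2) in blast)
  then show "S \<subseteq> A" by simp
qed (use assms(1) conn_on_def in metis)

text \<open>A part closed under edges swallows every member that it meets; so it contains the common
  vertex \<open>a\<close>, and through \<open>a\<close> all other members. This later yields the
  component of a vertex outside a bag.\<close>

lemma conn_on_Union:
  assumes conn: "\<And>S. S \<in> \<S> \<Longrightarrow> conn_on E S \<and> a \<in> S" and "\<S> \<noteq> {}" and "sym E"
  shows "conn_on E (\<Union>\<S>)"
proof (rule conn_onI)
  show "\<Union>\<S> \<noteq> {}" using assms(2) conn by fastforce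
next
  fix A x assume A: "A \<subseteq> \<Union>\<S>" "x \<in> A"
    and cut: "\<And>x y. x \<in> A \<Longrightarrow> y \<in> \<Union>\<S> - A \<Longrightarrow> (x, y) \<notin> E"
  have all: "S \<subseteq> A" if S: "S \<in> \<S>" and z: "z \<in> S" "z \<in> A" for S z
  proof -
    have "A \<inter> S = S" by (rule conn_onD[of E S _ z]) (use conn S cut z in auto)
    then show ?thesis by blast
  qed
  obtain S where "S \<in> \<S>" "x \<in> S" using A by blast
  then have "a \<in> A" using all[of S x] A(2) conn[of S] by blast
  then show "\<Union>\<S> \<subseteq> A" using all[of _ a] conn by (meson Union_least)
qed

lemma conn_on_Un:
  assumes "conn_on E S" "conn_on E T" "a \<in> S" "a \<in> T" "sym E"
  shows "conn_on E (S \<union> T)"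
  using conn_on_Union[of "{S, T}" E a] assms by auto

lemma conn_on_image:
  assumes "conn_on E S" "\<And>x y. (x, y) \<in> E \<Longrightarrow> x \<in> S \<Longrightarrow> y \<in> S \<Longrightarrow> (f x, f y) \<in> F"
  shows "conn_on F (f ` S)"
proof (rule conn_onI)
  show "f ` S \<noteq> {}" using assms(1) unfolding conn_on_def by (metis image_is_empty)
next
  fix A x assume A: "A \<subseteq> f ` S" "x \<in> A"
    and cut: "\<And>x y. x \<in> A \<Longrightarrow> y \<in> f ` S - A \<Longrightarrow> (x, y) \<notin> F"
  obtain z where z: "z \<in> S" "f z \<in> A" using A by blast
  have "{s \<in> S. f s \<in> A} = S"
    by (rule conn_onD[OF assms(1), of _ z]) (use z cut assms(2) in auto)
  then show "f ` S \<subseteq> A" by blast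
qed

lemma conn_on_edge:
  assumes "(x, y) \<in> E" "(y, x) \<in> E"
  shows "conn_on E {x, y}"
  by (rule conn_onI) (use assms in auto)

lemma conn_on_insert:
  assumes "conn_on E S" "t \<in> S" "(s, t) \<in> E" "(t, s) \<in> E" "sym E"
  shows "conn_on E (insert s S)"
proof -
  have "conn_on E (S \<union> {s, t})"
    using conn_on_Un[OF assms(1) conn_on_edge[OF assms(3,4)] assms(2) _ assms(5)] by simp
  moreover have "S \<union> {s, t} = insert s S" using assms(2) by blast
  ultimately show ?thesis by simp
qed

text \<open>Let \<open>A\<close> be closed within \<open>S - {v}\<close>. If \<open>v\<close> has no
  neighbour in \<open>A\<close>, then \<open>A\<close> is closed in \<open>S\<close> as well.
  Otherwise the only neighbour of \<open>v\<close> lies in \<open>A\<close>, and it is the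
  complement of \<open>A\<close> in \<open>S - {v}\<close> that is closed in
  \<open>S\<close>.\<close>

lemma conn_on_remove_leaf:
  assumes "conn_on E S" "sym E" "S \<noteq> {v}"
    and leaf: "\<And>x y. x \<in> S \<Longrightarrow> y \<in> S \<Longrightarrow> (v, x) \<in> E \<Longrightarrow> (v, y) \<in> E \<Longrightarrow> x = y"
  shows "conn_on E (S - {v})"
proof (rule conn_onI)
  have "S \<noteq> {}" using assms(1) unfolding conn_on_def by (rule conjunct1)
  then show "S - {v} \<noteq> {}" using assms(3) by blast
next
  fix A x assume A: "A \<subseteq> S - {v}" "x \<in> A"
    and cut: "\<And>x y. x \<in> A \<Longrightarrow> y \<in> S - {v} - A \<Longrightarrow> (x, y) \<notin> E"
  show "S - {v} \<subseteq> A"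
  proof (rule ccontr)
    assume "\<not> S - {v} \<subseteq> A"
    then obtain z where z: "z \<in> S - {v} - A" by blast
    show False
    proof (cases "\<exists>y\<in>A. (v, y) \<in> E")
      case False
      have "(x, y) \<notin> E" if "x \<in> A" "y \<in> S - A" for x y
      proof (cases "y = v")
        case True
        then show ?thesis using False that(1) assms(2) by (meson symD)
      next
        case False
        then show ?thesis using cut[OF that(1)] that(2) by simp
      qed
      moreover have "A \<subseteq> S" using A(1) by blast
      ultimately have "A = S" using conn_onD[OF assms(1) _ A(2)] by simp
      then show False using z by blast
    next
      case True
      then obtain a where a: "a \<in> A" "(v, a) \<in> E" by blast
      have "(x, y) \<notin> E" if x: "x \<in> S - {v} - A" and y: "y \<in> S - (S - {v} - A)" for x y
      proof (cases "y = v")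
        case True
        have "(v, x) \<notin> E" using leaf[OF _ _ a(2), of x] x a(1) A(1) by blast
        then show ?thesis using True assms(2) by (meson symD)
      next
        case False
        then have "(y, x) \<notin> E" using cut[OF _ x] y by simp
        then show ?thesis using assms(2) by (meson symD)
      qed
      moreover have "S - {v} - A \<subseteq> S" by blast
      ultimately have "S - {v} - A = S" using conn_onD[OF assms(1) _ z] by simp
      then show False using A(1,2) by blast
    qed
  qed
qed

text \<open>Induction by deleting a leaf \<open>v\<close>. If \<open>{v}\<close> is a member,
  pairwise intersection puts \<open>v\<close> into all members. Otherwise each member through
  \<open>v\<close> also contains the single neighbour of \<open>v\<close>, so members that meet at
  \<open>v\<close> still meet there after the deletion.\<close>

lemma subtrees_Helly:
  assumes "finite V" "forest_on E V" "sym E" "\<F> \<noteq> {}"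
    and "\<And>S. S \<in> \<F> \<Longrightarrow> conn_on E S \<and> S \<subseteq> V"
    and "\<And>S S'. S \<in> \<F> \<Longrightarrow> S' \<in> \<F> \<Longrightarrow> S \<inter> S' \<noteq> {}"
  shows "\<exists>t\<in>V. \<forall>S\<in>\<F>. t \<in> S"
  using assms(1,2,4,5,6)
proof (induction "card V" arbitrary: V \<F>)
  case 0
  then have "V = {}" by auto
  then have "S = {}" "S \<noteq> {}" if "S \<in> \<F>" for S
    using 0(5)[OF that] unfolding conn_on_def by blast+
  then show ?case using 0(4) by blast
next
  case (Suc n)
  then have "V \<noteq> {}" by auto
  then obtain v where v: "v \<in> V"
    and leaf: "\<And>x y. x \<in> V \<Longrightarrow> y \<in> V \<Longrightarrow> (v, x) \<in> E \<Longrightarrow> (v, y) \<in> E \<Longrightarrow> x = y"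
    using Suc.prems(2)[unfolded forest_on_def, rule_format, of V] by blast
  show ?case
  proof (cases "{v} \<in> \<F>")
    case True
    then have "\<forall>S\<in>\<F>. v \<in> S" using Suc.prems(5)[OF True] by blast
    then show ?thesis using v by blast
  next
    case False
    let ?G = "(\<lambda>S. S - {v}) ` \<F>"
    have nbr: "\<exists>y\<in>S - {v}. (v, y) \<in> E" if "S \<in> \<F>" "v \<in> S" for S
    proof (rule ccontr)
      assume "\<not> ?thesis"
      then have "{v} = S"
        using conn_onD[of E S "{v}" v] Suc.prems(4)[OF that(1)] that(2) by simp
      then show False using False that by blast
    qed
    have "\<exists>t\<in>V - {v}. \<forall>S\<in>?G. t \<in> S"
    proof (rule Suc.hyps(1))
      show "n = card (V - {v})" using Suc.hyps(2) Suc.prems(1) v by simp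
      show "finite (V - {v})" "?G \<noteq> {}" using Suc.prems by auto
      show "forest_on E (V - {v})" using Suc.prems(2) unfolding forest_on_def by blast
    next
      fix S assume "S \<in> ?G"
      then obtain S0 where S0: "S0 \<in> \<F>" "S = S0 - {v}" by blast
      have "conn_on E (S0 - {v})"
      proof (rule conn_on_remove_leaf)
        show "conn_on E S0" "sym E" "S0 \<noteq> {v}" using Suc.prems(4)[OF S0(1)] assms(3) False S0(1) by auto
        show "x = y" if "x \<in> S0" "y \<in> S0" "(v, x) \<in> E" "(v, y) \<in> E" for x y
          using leaf that Suc.prems(4)[OF S0(1)] by blast
      qed
      then show "conn_on E S \<and> S \<subseteq> V - {v}" using S0 Suc.prems(4)[OF S0(1)] by blast
    next
      fix S S' assume "S \<in> ?G" and "S' \<in> ?G"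
      then obtain S0 S1 where S: "S0 \<in> \<F>" "S = S0 - {v}" "S1 \<in> \<F>" "S' = S1 - {v}" by blast
      obtain z where z: "z \<in> S0" "z \<in> S1" using Suc.prems(5)[OF S(1,3)] by blast
      show "S \<inter> S' \<noteq> {}"
      proof (cases "z = v")
        case True
        then obtain y y' where "y \<in> S0 - {v}" "(v, y) \<in> E" "y' \<in> S1 - {v}" "(v, y') \<in> E"
          using nbr z S(1,3) by blast
        moreover from this have "y = y'"
          using leaf[of y y'] Suc.prems(4)[OF S(1)] Suc.prems(4)[OF S(3)] by blast
        ultimately show ?thesis using S by blast
      qed (use z S in blast)
    qed
    then obtain t where t: "t \<in> V" "\<forall>S\<in>?G. t \<in> S" by blast
    then have "t \<in> S" if "S \<in> \<F>" for S using that by auto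
    then show ?thesis using t(1) by blast
  qed
qed

section \<open>Trees and tree decompositions in terms of cuts and leaves\<close>

text \<open>Reachability and cuts are matched through closed sets: a closed set contains everything
  reachable from its elements, and the set of vertices reachable from \<open>u\<close> is closed. As
  the arcs are symmetric already, \<open>mk_symmetric\<close> adds nothing to the induced
  ones.\<close>

lemma connected_induce_iff_conn_on:
  assumes "sym (parcs T)" "S \<subseteq> pverts T"
  shows "Digraph_Component.connected (with_proj T \<restriction> S) \<longleftrightarrow> conn_on (parcs T) S"
proof -
  let ?F = "parcs T \<inter> S \<times> S"
  have arcs: "parcs (mk_symmetric (with_proj T \<restriction> S)) = ?F"
    using assms by (auto simp: parcs_mk_symmetric dest: symD)
  have "Digraph_Component.connected (with_proj T \<restriction> S) \<longleftrightarrow>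
      S \<noteq> {} \<and> (\<forall>u\<in>S. \<forall>v\<in>S. (u, v) \<in> rtrancl_on S ?F)" (is "_ \<longleftrightarrow> ?R")
    using arcs by (simp add: Digraph_Component.connected_def strongly_connected_def reachable_def)
  also have "\<dots> \<longleftrightarrow> conn_on (parcs T) S"
  proof
    assume R: ?R
    show "conn_on (parcs T) S"
    proof (rule conn_onI)
      fix A x assume A: "A \<subseteq> S" "x \<in> A"
        and cut: "\<And>x y. x \<in> A \<Longrightarrow> y \<in> S - A \<Longrightarrow> (x, y) \<notin> parcs T"
      have "y \<in> A" if "(x, y) \<in> rtrancl_on S ?F" for y
        using that
      proof (induction rule: rtrancl_on_induct)
        case (step y z)
        then show ?case using cut[of y z] by blast
      qed (rule A(2))
      then show "S \<subseteq> A" using R A by blast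
    qed (use R in blast)
  next
    assume C: "conn_on (parcs T) S"
    have "(u, v) \<in> rtrancl_on S ?F" if "u \<in> S" "v \<in> S" for u v
    proof -
      have "{w \<in> S. (u, w) \<in> rtrancl_on S ?F} = S"
        by (rule conn_onD[OF C, of _ u])
          (use \<open>u \<in> S\<close> in \<open>auto intro: rtrancl_on_into_rtrancl_on\<close>)
      then show ?thesis using that by blast
    qed
    moreover have "S \<noteq> {}" using C unfolding conn_on_def by (rule conjunct1)
    ultimately show ?R by blast
  qed
  finally show ?thesis .
qed

lemma connected_iff_conn_on:
  assumes "pair_graph T"
  shows "Digraph_Component.connected (with_proj T) \<longleftrightarrow> conn_on (parcs T) (pverts T)"
proof -
  interpret pair_graph T by fact
  have "with_proj T \<restriction> pverts T = with_proj T"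
    by (auto simp: induce_subgraph_def with_proj_def wellformed')
  moreover have "sym (parcs T)" using pair_sym_arcs by (simp add: symmetric_def)
  ultimately show ?thesis using connected_induce_iff_conn_on[of T "pverts T"] by simp
qed

text \<open>Turns a stretch of a vertex sequence into an arc list. The start \<open>i\<close> is
  arbitrary because the recursion takes arcs off the front.\<close>

lemma pawalk_verts_steps:
  "pawalk_verts (f i) (map (\<lambda>m. (f m, f (Suc m))) [i..<i + n]) = map f [i..<Suc (i + n)]"
proof (induction n arbitrary: i)
  case (Suc n)
  show ?case using Suc[of "Suc i"] by (simp add: upt_conv_Cons del: upt_Suc)
qed simp

lemma pcas_steps: "pcas (f i) (map (\<lambda>m. (f m, f (Suc m))) [i..<i + n]) (f (i + n))"
proof (induction n arbitrary: i)
  case (Suc n)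
  show ?case using Suc[of "Suc i"] by (simp add: upt_conv_Cons del: upt_Suc)
qed simp

lemma pcas_nth:
  assumes "pcas u p v"
  shows "length (pawalk_verts u p) = Suc (length p)"
    and "pawalk_verts u p ! 0 = u" "pawalk_verts u p ! length p = v"
    and "\<And>i. i < length p \<Longrightarrow> p ! i = (pawalk_verts u p ! i, pawalk_verts u p ! Suc i)"
proof -
  show len: "length (pawalk_verts u p) = Suc (length p)" for u
    by (induction p arbitrary: u) auto
  show zero: "pawalk_verts u p ! 0 = u" using assms by (cases p) auto
  show "pawalk_verts u p ! length p = v" using assms by (induction p arbitrary: u) auto
  show "p ! i = (pawalk_verts u p ! i, pawalk_verts u p ! Suc i)" if "i < length p" for i
    using assms that
  proof (induction p arbitrary: u i)
    case (Cons e p)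
    have "pawalk_verts (snd e) p ! 0 = snd e" by (cases p) (use Cons.prems in auto)
    then show ?case using Cons by (cases i) (auto simp: prod_eq_iff)
  qed simp
qed

lemma undirected_tree_imp_forest_on:
  assumes "undirected_tree T"
  shows "forest_on (parcs T) (pverts T)"
  unfolding forest_on_def
proof (intro allI impI)
  fix U assume U: "U \<subseteq> pverts T" "U \<noteq> {}"
  let ?E = "parcs T"
  interpret pair_graph T using assms unfolding undirected_tree_def by blast
  have acyc: "\<And>p. pre_digraph.cycle (with_proj T) p \<Longrightarrow> length p < 3"
    using assms unfolding undirected_tree_def by (meson not_le)
  show "\<exists>v\<in>U. \<forall>x\<in>U. \<forall>y\<in>U. (v, x) \<in> ?E \<longrightarrow> (v, y) \<in> ?E \<longrightarrow> x = y"
  proof (rule ccontr)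
    assume "\<not> ?thesis"
    then have two: "\<exists>y\<in>U. (v, y) \<in> ?E \<and> y \<noteq> x" if "v \<in> U" for v x
      using that by metis
    then have "\<forall>x v. \<exists>y. v \<in> U \<longrightarrow> y \<in> U \<and> (v, y) \<in> ?E \<and> y \<noteq> x" by blast
    \<comment> \<open>\<open>nxt x v\<close> continues a walk that enters \<open>v\<close> from \<open>x\<close> without turning back; the shortest
      closed stretch of such a walk is a cycle of length at least 3.\<close>
    then obtain nxt where "\<forall>x v. v \<in> U \<longrightarrow> nxt x v \<in> U \<and> (v, nxt x v) \<in> ?E \<and> nxt x v \<noteq> x"
      by (subst (asm) choice_iff, subst (asm) choice_iff) blast
    then have nxt: "nxt x v \<in> U \<and> (v, nxt x v) \<in> ?E \<and> nxt x v \<noteq> x" if "v \<in> U" for x v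
      using that by blast
    obtain u0 where u0: "u0 \<in> U" using U by blast
    \<comment> \<open>The next vertex depends on the previous one too, so the iteration runs over
      pairs of consecutive vertices.\<close>
    define g where "g = rec_nat (u0, nxt u0 u0) (\<lambda>_ (a, b). (b, nxt a b))"
    define f where "f n = fst (g n)" for n
    have g_Suc: "g (Suc n) = (snd (g n), nxt (fst (g n)) (snd (g n)))" for n
      by (simp add: g_def split_beta)
    have inv: "fst (g n) \<in> U \<and> snd (g n) \<in> U \<and> (fst (g n), snd (g n)) \<in> ?E" for n
    proof (induction n)
      case 0
      then show ?case using nxt[OF u0] u0 by (simp add: g_def)
    next
      case (Suc n)
      then show ?case using nxt[of "snd (g n)" "fst (g n)"] by (simp add: g_Suc)
    qed
    have fU: "f n \<in> U" and fE: "(f n, f (Suc n)) \<in> ?E" and fne: "f (Suc (Suc n)) \<noteq> f n" for n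
      using inv[of n] nxt[of "snd (g n)" "fst (g n)"] by (simp_all add: f_def g_Suc)
    have "finite U" using U(1) pair_finite_verts finite_subset by blast
    then have "\<not> inj f"
      using fU by (meson finite_subset image_subsetI infinite_UNIV_nat finite_imageD)
    then have ex: "\<exists>d i. 0 < d \<and> f (i + d) = f i"
      unfolding inj_def by (metis add_diff_inverse_nat less_not_sym linorder_neqE_nat zero_less_diff)
    \<comment> \<open>Minimal over all starting points at once, so any further repetition inside a
      closed stretch of length \<open>d\<close> would contradict minimality.\<close>
    define d where "d = (LEAST d. 0 < d \<and> (\<exists>i. f (i + d) = f i))"
    have "0 < d \<and> (\<exists>i. f (i + d) = f i)"
      unfolding d_def by (rule LeastI_ex) (use ex in blast)
    then obtain i where d: "0 < d" "f (i + d) = f i" by blast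
    have dmin: "d \<le> e" if "0 < e" "f (j + e) = f j" for e j
      unfolding d_def by (rule Least_le) (use that in blast)
    \<comment> \<open>A repetition at distance 1 is a loop, one at distance 2 turns back; neither
      occurs.\<close>
    have "d \<noteq> 1" using fE[of i] d(2) pair_no_loops by fastforce
    moreover have "d \<noteq> 2" using fne[of i] d(2) by auto
    ultimately have d3: "3 \<le> d" using d(1) by simp
    define p where "p = map (\<lambda>m. (f m, f (Suc m))) [i..<i + d]"
    have vs: "pawalk_verts (f i) p = map f [i..<Suc (i + d)]"
      unfolding p_def by (rule pawalk_verts_steps)
    \<comment> \<open>The range starts at \<open>Suc i\<close> because \<open>f i\<close> and
      \<open>f (i + d)\<close> are the same vertex; a cycle has to be distinct on the tail of its
      vertex list.\<close>
    have inj: "f a \<noteq> f b" if "Suc i \<le> a" "a < b" "b < Suc (i + d)" for a b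
      using dmin[of "b - a" a] that by auto
    have "inj_on f {Suc i..<Suc (i + d)}"
      by (rule linorder_inj_onI) (use inj in auto)
    then have "distinct (tl (pawalk_verts (f i) p))"
      unfolding vs by (simp add: map_tl[symmetric] tl_upt distinct_map del: upt_Suc)
    moreover have "awalk (f i) p (f i)"
      unfolding awalk_def using fU[of i] U(1) pcas_steps[of f i d] fE d(2)
      by (auto simp: p_def)
    moreover have "p \<noteq> []" using d by (simp add: p_def)
    ultimately have "cycle p" unfolding cycle_def by auto
    then show False using acyc[of p] d3 by (simp add: p_def)
  qed
qed

text \<open>The vertices of a cycle of length at least 3 form a set without a leaf: each has its
  predecessor and its successor on the cycle as two different neighbours.\<close>

lemma forest_on_imp_no_cycle:
  assumes "sym (parcs T)" "forest_on (parcs T) (pverts T)" "pair_wf_digraph T"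
    and "pre_digraph.cycle (with_proj T) p"
  shows "length p < 3"
proof (rule ccontr)
  assume "\<not> length p < 3"
  then have n3: "3 \<le> length p" by simp
  interpret pair_wf_digraph T by fact
  obtain u where aw: "awalk u p u" and dist: "distinct (tl (pawalk_verts u p))"
    using assms(4) unfolding cycle_def by blast
  define n where "n = length p"
  \<comment> \<open>Shifted by one because distinctness is known for the tail of the vertex list;
    the base point \<open>u\<close> reappears as \<open>w (n - 1)\<close>.\<close>
  define w where "w i = pawalk_verts u p ! Suc i" for i
  have cas: "pcas u p u" and arcs: "set p \<subseteq> parcs T" using aw unfolding awalk_def by auto
  note nth = pcas_nth[OF cas]
  have w_tl: "w i = tl (pawalk_verts u p) ! i" if "i < n" for i
    using that nth(1) by (simp add: w_def n_def nth_tl)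
  have w_inj: "i = j" if "i < n" "j < n" "w i = w j" for i j
    using that dist nth(1) w_tl by (simp add: nth_eq_iff_index_eq n_def)
  have "Suc (n - 1) = length p" using n3 by (simp add: n_def)
  then have w_last: "w (n - 1) = u" using nth(3) by (simp add: w_def)
  have first: "(u, w 0) \<in> parcs T"
  proof -
    have "p ! 0 \<in> parcs T" using arcs n3 nth_mem[of 0 p] by (cases p) auto
    moreover have "0 < length p" using n3 by linarith
    ultimately show ?thesis using nth(2) nth(4)[of 0] unfolding w_def by metis
  qed
  have step: "(w i, w (Suc i)) \<in> parcs T" if "Suc i < n" for i
  proof -
    have "p ! Suc i \<in> parcs T" using arcs that nth_mem[of "Suc i" p] by (auto simp: n_def)
    then show ?thesis using nth(4)[of "Suc i"] that by (simp add: w_def n_def)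
  qed
  let ?U = "w ` {..<n}"
  have "?U \<subseteq> pverts T"
  proof
    fix x assume "x \<in> ?U"
    then obtain i where "i < n" "x = w i" by blast
    then show "x \<in> pverts T" using step[of "i - 1"] first wellformed' by (cases i) auto
  qed
  moreover have "?U \<noteq> {}"
  proof -
    have "0 < n" using n3 unfolding n_def by linarith
    then show ?thesis by blast
  qed
  ultimately have "\<exists>v\<in>?U. \<forall>x\<in>?U. \<forall>y\<in>?U. (v, x) \<in> parcs T \<longrightarrow> (v, y) \<in> parcs T \<longrightarrow> x = y"
    using assms(2)[unfolded forest_on_def, rule_format, of ?U] by blast
  then obtain i where i: "i < n"
    and leaf: "\<And>x y. x \<in> ?U \<Longrightarrow> y \<in> ?U \<Longrightarrow> (w i, x) \<in> parcs T \<Longrightarrow> (w i, y) \<in> parcs T \<Longrightarrow> x = y"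
    by blast
  \<comment> \<open>Cyclic successor and predecessor of \<open>i\<close>; they differ since
    \<open>n\<close> is at least 3.\<close>
  define a where "a = (if Suc i = n then 0 else Suc i)"
  define b where "b = (if i = 0 then n - 1 else i - 1)"
  have ab: "a < n" "b < n" "a \<noteq> b" using i n3 by (auto simp: a_def b_def n_def)
  have "(w i, w a) \<in> parcs T"
    using step[of i] first w_last i by (auto simp: a_def)
  moreover have "(w b, w i) \<in> parcs T"
    using step[of "i - 1"] first w_last i by (auto simp: b_def)
  then have "(w i, w b) \<in> parcs T" using assms(1) by (meson symD)
  ultimately have "w a = w b" using leaf ab by blast
  then show False using w_inj ab by blast
qed

lemma undirected_tree_iff:
  "undirected_tree T \<longleftrightarrow>
    pair_graph T \<and> conn_on (parcs T) (pverts T) \<and> forest_on (parcs T) (pverts T)"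
proof
  assume T: "undirected_tree T"
  then show "pair_graph T \<and> conn_on (parcs T) (pverts T) \<and> forest_on (parcs T) (pverts T)"
    using undirected_tree_imp_forest_on[OF T] connected_iff_conn_on[of T]
    unfolding undirected_tree_def by blast
next
  assume T: "pair_graph T \<and> conn_on (parcs T) (pverts T) \<and> forest_on (parcs T) (pverts T)"
  then interpret pair_graph T by blast
  have "sym (parcs T)" using pair_sym_arcs by (simp add: symmetric_def)
  then have "length p < 3" if "pre_digraph.cycle (with_proj T) p" for p
    using forest_on_imp_no_cycle[OF _ _ _ that] T pair_wf_digraph_axioms by blast
  then show "undirected_tree T"
    using T connected_iff_conn_on[of T] unfolding undirected_tree_def by (meson not_le)
qed

lemma pair_graph_sym: "pair_graph G \<Longrightarrow> sym (parcs G)"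
proof -
  assume "pair_graph G"
  then interpret pair_graph G .
  show ?thesis using pair_sym_arcs by (simp add: symmetric_def)
qed

lemma pair_graph_finite: "pair_graph G \<Longrightarrow> finite (pverts G)"
proof -
  assume "pair_graph G"
  then interpret pair_graph G .
  show ?thesis by (rule pair_finite_verts)
qed

lemma pair_graph_arc_verts: "pair_graph G \<Longrightarrow> (u, v) \<in> parcs G \<Longrightarrow> u \<in> pverts G \<and> v \<in> pverts G"
proof -
  assume "pair_graph G" and uv: "(u, v) \<in> parcs G"
  then interpret pair_graph G by blast
  show ?thesis using uv by (blast dest: wellformed')
qed

lemma tree_decomposition_iff:
  "tree_decomposition G T X \<longleftrightarrow>
    pair_graph T \<and> conn_on (parcs T) (pverts T) \<and> forest_on (parcs T) (pverts T) \<and>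
    (\<Union>t\<in>pverts T. X t) = pverts G \<and>
    (\<forall>(u, v)\<in>parcs G. \<exists>t\<in>pverts T. u \<in> X t \<and> v \<in> X t) \<and>
    (\<forall>v\<in>pverts G. conn_on (parcs T) {t \<in> pverts T. v \<in> X t})"
proof -
  have "Digraph_Component.connected (with_proj T \<restriction> {t \<in> pverts T. v \<in> X t}) \<longleftrightarrow>
      conn_on (parcs T) {t \<in> pverts T. v \<in> X t}" if "pair_graph T" for v
    by (rule connected_induce_iff_conn_on) (use pair_graph_sym[OF that] in auto)
  then show ?thesis
    unfolding tree_decomposition_def undirected_tree_iff by (metis (no_types, lifting))
qed

section \<open>Treewidth, brambles and cliques\<close>

lemma tree_decomposition_mono:
  assumes "tree_decomposition G T X" "pverts H = pverts G" "parcs H \<subseteq> parcs G"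
  shows "tree_decomposition H T X"
  using assms unfolding tree_decomposition_def by auto

lemma treewidth_le:
  fixes T :: "nat pair_pre_digraph"
  assumes dec: "tree_decomposition G T X"
    and "\<And>t. t \<in> pverts T \<Longrightarrow> card (X t) \<le> w + 1"
  shows "treewidth G \<le> w"
proof -
  have T: "pair_graph T" "conn_on (parcs T) (pverts T)"
    using dec unfolding tree_decomposition_iff by blast+
  then have "finite (pverts T)" "pverts T \<noteq> {}"
    using pair_graph_finite unfolding conn_on_def by blast+
  then have "Max ((\<lambda>t. card (X t)) ` pverts T) \<le> w + 1"
    using assms(2) by (subst Max_le_iff) auto
  then have "decomposition_width T X \<le> w" by (simp add: decomposition_width_def)
  moreover have "treewidth G \<le> decomposition_width T X"
    unfolding treewidth_def by (rule Least_le) (use dec in blast)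
  ultimately show ?thesis by simp
qed

lemma optimal_tree_decomposition:
  assumes "pair_graph G"
  obtains T :: "nat pair_pre_digraph" and X where "tree_decomposition G T X"
    and "\<And>t. t \<in> pverts T \<Longrightarrow> card (X t) \<le> treewidth G + 1"
proof -
  have "\<exists>(T :: nat pair_pre_digraph) X.
      tree_decomposition G T X \<and> decomposition_width T X = treewidth G"
    unfolding treewidth_def by (rule LeastI_ex) (use ex_tree_decomposition[OF assms] in blast)
  then obtain T :: "nat pair_pre_digraph" and X
    where dec: "tree_decomposition G T X" and w: "decomposition_width T X = treewidth G"
    by blast
  have "finite (pverts T)"
    using dec pair_graph_finite unfolding tree_decomposition_iff by blast
  then have "card (X t) \<le> Max ((\<lambda>t. card (X t)) ` pverts T)" if "t \<in> pverts T" for t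
    using that by (intro Max_ge) auto
  \<comment> \<open>Truncation is harmless here: m is at most (m - 1) + 1 also for m = 0.\<close>
  then have "card (X t) \<le> treewidth G + 1" if "t \<in> pverts T" for t
    using that w unfolding decomposition_width_def by fastforce
  then show thesis using that dec by blast
qed

text \<open>Let \<open>A\<close> be closed among the nodes whose bags meet \<open>S\<close>. It
  contains the whole subtree of a vertex of \<open>S\<close> once it contains one node of it, and it
  passes on to the neighbours of that vertex in \<open>S\<close> because an edge lies in a common
  bag.\<close>

lemma conn_on_meeting_bags:
  assumes dec: "tree_decomposition G T X" and S: "conn_on (parcs G) S" "S \<subseteq> pverts G"
  shows "conn_on (parcs T) {t \<in> pverts T. X t \<inter> S \<noteq> {}}" (is "conn_on _ ?TS")
proof (rule conn_onI)
  have cover: "(\<Union>t\<in>pverts T. X t) = pverts G"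
    and edge: "\<And>u v. (u, v) \<in> parcs G \<Longrightarrow> \<exists>t\<in>pverts T. u \<in> X t \<and> v \<in> X t"
    and bags: "\<And>v. v \<in> pverts G \<Longrightarrow> conn_on (parcs T) {t \<in> pverts T. v \<in> X t}"
    using dec unfolding tree_decomposition_iff by blast+
  obtain v where "v \<in> S" using S(1) unfolding conn_on_def by blast
  then show "?TS \<noteq> {}" using cover S(2) by fastforce
  fix A t assume A: "A \<subseteq> ?TS" "t \<in> A"
    and cut: "\<And>x y. x \<in> A \<Longrightarrow> y \<in> ?TS - A \<Longrightarrow> (x, y) \<notin> parcs T"
  have all: "{t \<in> pverts T. v \<in> X t} \<subseteq> A" if v: "v \<in> S" "s \<in> A" "v \<in> X s" for v s
  proof -
    have "s \<in> A \<inter> {t \<in> pverts T. v \<in> X t}" using v A(1) by blast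
    moreover have "(x, y) \<notin> parcs T"
      if "x \<in> A \<inter> {t \<in> pverts T. v \<in> X t}" "y \<in> {t \<in> pverts T. v \<in> X t} - (A \<inter> {t \<in> pverts T. v \<in> X t})"
      for x y
      using cut[of x y] that v(1) by blast
    ultimately have "A \<inter> {t \<in> pverts T. v \<in> X t} = {t \<in> pverts T. v \<in> X t}"
      using conn_onD[OF bags[of v], of "A \<inter> {t \<in> pverts T. v \<in> X t}" s] v(1) S(2) by blast
    then show ?thesis by blast
  qed
  define S1 where "S1 = {v \<in> S. \<exists>s\<in>A. v \<in> X s}"
  obtain v where v: "v \<in> S1" using A unfolding S1_def by blast
  have "(x, y) \<notin> parcs G" if xy: "x \<in> S1" "y \<in> S - S1" for x y
  proof
    assume "(x, y) \<in> parcs G"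
    then obtain r where r: "r \<in> pverts T" "x \<in> X r" "y \<in> X r" using edge by blast
    obtain s where "s \<in> A" "x \<in> X s" "x \<in> S" using xy(1) unfolding S1_def by blast
    then have "r \<in> A" using all[of x s] r by blast
    then show False using xy(2) r(3) unfolding S1_def by blast
  qed
  moreover have "S1 \<subseteq> S" unfolding S1_def by blast
  ultimately have S1: "S1 = S" using conn_onD[OF S(1) _ v] by simp
  show "?TS \<subseteq> A"
  proof
    fix r assume "r \<in> ?TS"
    then obtain x where x: "r \<in> pverts T" "x \<in> X r" "x \<in> S1" using S1 by blast
    then obtain s where "s \<in> A" "x \<in> X s" "x \<in> S" unfolding S1_def by blast
    then show "r \<in> A" using all[of x s] x by blast
  qed
qed

text \<open>The easy half of the duality between brambles and treewidth. Touching sets have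
  intersecting node sets, since a common vertex or a joining edge lies in one bag; the Helly
  property does the rest.\<close>

lemma bramble_hit_by_bag:
  assumes dec: "tree_decomposition G T X" and "\<B> \<noteq> {}"
    and conn: "\<And>S. S \<in> \<B> \<Longrightarrow> conn_on (parcs G) S \<and> S \<subseteq> pverts G"
    and touch: "\<And>S S'. S \<in> \<B> \<Longrightarrow> S' \<in> \<B> \<Longrightarrow> \<exists>x\<in>S. \<exists>y\<in>S'. x = y \<or> (x, y) \<in> parcs G"
  obtains t where "t \<in> pverts T" "\<And>S. S \<in> \<B> \<Longrightarrow> X t \<inter> S \<noteq> {}"
proof -
  let ?m = "\<lambda>S. {t \<in> pverts T. X t \<inter> S \<noteq> {}}"
  have T: "pair_graph T" "forest_on (parcs T) (pverts T)"
    and cover: "(\<Union>t\<in>pverts T. X t) = pverts G"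
    and edge: "\<And>u v. (u, v) \<in> parcs G \<Longrightarrow> \<exists>t\<in>pverts T. u \<in> X t \<and> v \<in> X t"
    using dec unfolding tree_decomposition_iff by blast+
  have "\<exists>t\<in>pverts T. \<forall>S\<in>?m ` \<B>. t \<in> S"
  proof (rule subtrees_Helly)
    show "finite (pverts T)" "sym (parcs T)" using T(1) pair_graph_finite pair_graph_sym by auto
    show "forest_on (parcs T) (pverts T)" by fact
    show "?m ` \<B> \<noteq> {}" using assms(2) by blast
  next
    fix S assume "S \<in> ?m ` \<B>"
    then show "conn_on (parcs T) S \<and> S \<subseteq> pverts T"
      using conn_on_meeting_bags[OF dec] conn by blast
  next
    fix M M' assume "M \<in> ?m ` \<B>" and "M' \<in> ?m ` \<B>"
    then obtain S S' where S: "S \<in> \<B>" "M = ?m S" "S' \<in> \<B>" "M' = ?m S'" by blast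
    then obtain x y where xy: "x \<in> S" "y \<in> S'" "x = y \<or> (x, y) \<in> parcs G" using touch by blast
    have "\<exists>t\<in>pverts T. x \<in> X t \<and> y \<in> X t"
    proof (cases "x = y")
      case True
      then show ?thesis using cover conn[OF S(1)] xy(1) by blast
    next
      case False
      then show ?thesis using edge xy(3) by blast
    qed
    then show "M \<inter> M' \<noteq> {}" using S xy by blast
  qed
  then obtain t where "t \<in> pverts T" "\<forall>S\<in>?m ` \<B>. t \<in> S" by blast
  then show thesis using that by auto
qed

text \<open>The singletons of the vertices of a clique touch pairwise, hence form a bramble.\<close>

lemma clique_in_bag:
  assumes dec: "tree_decomposition G T X" and "K \<noteq> {}" "K \<subseteq> pverts G"
    and "\<And>u v. u \<in> K \<Longrightarrow> v \<in> K \<Longrightarrow> u \<noteq> v \<Longrightarrow> (u, v) \<in> parcs G"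
  obtains t where "t \<in> pverts T" "K \<subseteq> X t"
proof -
  have "\<exists>x\<in>S. \<exists>y\<in>S'. x = y \<or> (x, y) \<in> parcs G"
    if "S \<in> (\<lambda>v. {v}) ` K" "S' \<in> (\<lambda>v. {v}) ` K" for S S'
    using that assms(4) by blast
  then obtain t where t: "t \<in> pverts T" "\<And>S. S \<in> (\<lambda>v. {v}) ` K \<Longrightarrow> X t \<inter> S \<noteq> {}"
    using bramble_hit_by_bag[OF dec, of "(\<lambda>v. {v}) ` K"] assms(2,3) conn_on_singleton
    by (smt (verit, ccfv_SIG) image_iff image_is_empty insert_subset empty_subsetI subsetD)
  have "K \<subseteq> X t" using t(2) by blast
  then show thesis using that t(1) by blast
qed

section \<open>Attaching vertices to cliques\<close>

text \<open>Serves on both sides: in the graph a new vertex is joined to a set \<open>K\<close>, in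
  the tree a new leaf is hung at one node, with \<open>K = {t}\<close>.\<close>

definition attach :: "'a \<Rightarrow> 'a set \<Rightarrow> 'a pair_pre_digraph \<Rightarrow> 'a pair_pre_digraph" where
  "attach b K G = \<lparr> pverts = insert b (pverts G), parcs = parcs G \<union> {b} \<times> K \<union> K \<times> {b} \<rparr>"

lemma attach_simps [simp]:
  "pverts (attach b K G) = insert b (pverts G)"
  "parcs (attach b K G) = parcs G \<union> {b} \<times> K \<union> K \<times> {b}"
  by (simp_all add: attach_def)

lemma pair_graph_attach:
  assumes "pair_graph G" "K \<subseteq> pverts G" "b \<notin> pverts G"
  shows "pair_graph (attach b K G)"
proof -
  interpret pair_graph G by fact
  have "finite K" using assms(2) pair_finite_verts finite_subset by blast
  moreover have "sym (parcs G \<union> {b} \<times> K \<union> K \<times> {b})"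
    using pair_graph_sym[OF assms(1)] unfolding sym_def by blast
  ultimately show ?thesis
    using pair_finite_verts pair_finite_arcs pair_no_loops assms(2,3)
    by unfold_locales
      (auto simp: symmetric_def dest: wellformed' arc_fst_in_verts arc_snd_in_verts)
qed

text \<open>In a set that contains \<open>s\<close>, the new node itself is the leaf, as
  \<open>t\<close> is its only neighbour; other sets lie in the old tree.\<close>

lemma forest_on_attach:
  assumes "pair_graph T" "forest_on (parcs T) (pverts T)" "s \<notin> pverts T"
  shows "forest_on (parcs (attach s {t} T)) (insert s (pverts T))"
  unfolding forest_on_def
proof (intro allI impI)
  fix U assume U: "U \<subseteq> insert s (pverts T)" "U \<noteq> {}"
  let ?E = "parcs (attach s {t} T)"
  have ns: "(s, x) \<notin> parcs T" "(x, s) \<notin> parcs T" for x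
    using pair_graph_arc_verts[OF assms(1)] assms(3) by blast+
  show "\<exists>v\<in>U. \<forall>x\<in>U. \<forall>y\<in>U. (v, x) \<in> ?E \<longrightarrow> (v, y) \<in> ?E \<longrightarrow> x = y"
  proof (cases "s \<in> U")
    case True
    then show ?thesis using ns by (intro bexI[of _ s]) auto
  next
    case False
    then have "U \<subseteq> pverts T" using U by blast
    then obtain v where "v \<in> U" "\<forall>x\<in>U. \<forall>y\<in>U. (v, x) \<in> parcs T \<longrightarrow> (v, y) \<in> parcs T \<longrightarrow> x = y"
      using assms(2) U(2) unfolding forest_on_def by blast
    then show ?thesis using False by (intro bexI[of _ v]) auto
  qed
qed

text \<open>The subtree of \<open>b\<close> is the single node \<open>s\<close>. The subtree of a
  vertex of \<open>K\<close> grows by \<open>s\<close> and stays connected, since it contains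
  \<open>t\<close> already.\<close>

lemma tree_decomposition_attach:
  assumes dec: "tree_decomposition G T X" and t: "t \<in> pverts T" "K \<subseteq> X t"
    and b: "b \<notin> pverts G" and s: "s \<notin> pverts T"
  shows "tree_decomposition (attach b K G) (attach s {t} T) (X(s := insert b K))"
proof -
  let ?T = "attach s {t} T" and ?X = "X(s := insert b K)"
  have T: "pair_graph T" "conn_on (parcs T) (pverts T)" "forest_on (parcs T) (pverts T)"
    and cover: "(\<Union>t\<in>pverts T. X t) = pverts G"
    and edge: "\<And>u v. (u, v) \<in> parcs G \<Longrightarrow> \<exists>t\<in>pverts T. u \<in> X t \<and> v \<in> X t"
    and bags: "\<And>v. v \<in> pverts G \<Longrightarrow> conn_on (parcs T) {t \<in> pverts T. v \<in> X t}"
    using dec unfolding tree_decomposition_iff by blast+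
  have T': "pair_graph ?T" using pair_graph_attach[OF T(1) _ s] t(1) by simp
  have sym': "sym (parcs ?T)" using pair_graph_sym[OF T'] .
  have old: "conn_on (parcs ?T) S" if "conn_on (parcs T) S" for S
    by (rule conn_on_mono[OF that]) auto
  have new: "conn_on (parcs ?T) (insert s S)" if "conn_on (parcs T) S" "t \<in> S" for S
    using conn_on_insert[OF old[OF that(1)] that(2) _ _ sym', of s] by simp
  have Kv: "K \<subseteq> pverts G" using t cover by blast
  have same: "?X r = X r" if "r \<in> pverts T" for r using that s by auto
  have old_bag: "{r \<in> pverts ?T. v \<in> ?X r} =
      (if v \<in> K then insert s {r \<in> pverts T. v \<in> X r} else {r \<in> pverts T. v \<in> X r})"
    if "v \<in> pverts G" for v
    using that b s by auto
  have new_bag: "{r \<in> pverts ?T. b \<in> ?X r} = {s}"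
    using b cover by auto
  have "(\<Union>r\<in>pverts ?T. ?X r) = ?X s \<union> (\<Union>r\<in>pverts T. ?X r)" by simp
  also have "(\<Union>r\<in>pverts T. ?X r) = (\<Union>r\<in>pverts T. X r)"
    using same by (rule SUP_cong[OF refl])
  also have "?X s \<union> \<dots> = pverts (attach b K G)" using cover Kv by auto
  finally have "(\<Union>r\<in>pverts ?T. ?X r) = pverts (attach b K G)" .
  moreover have "\<exists>r\<in>pverts ?T. u \<in> ?X r \<and> v \<in> ?X r" if uv: "(u, v) \<in> parcs (attach b K G)" for u v
  proof (cases "(u, v) \<in> parcs G")
    case True
    then obtain r where "r \<in> pverts T" "u \<in> X r" "v \<in> X r" using edge by blast
    then show ?thesis using same[of r] by (intro bexI[of _ r]) auto
  next
    case False
    then show ?thesis using uv by (intro bexI[of _ s]) auto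
  qed
  moreover have "conn_on (parcs ?T) {r \<in> pverts ?T. v \<in> ?X r}" if "v \<in> pverts (attach b K G)" for v
  proof (cases "v = b")
    case True
    then show ?thesis using new_bag conn_on_singleton by metis
  next
    case False
    then have v: "v \<in> pverts G" using that by simp
    have "conn_on (parcs ?T) (insert s {r \<in> pverts T. v \<in> X r})" if "v \<in> K"
      by (rule new[OF bags[OF v]]) (use t that in blast)
    then show ?thesis unfolding old_bag[OF v] using old[OF bags[OF v]] by presburger
  qed
  moreover have "conn_on (parcs ?T) (pverts ?T)" using new[OF T(2) t(1)] by simp
  moreover have "forest_on (parcs ?T) (pverts ?T)"
    using forest_on_attach[OF T(1,3) s] by simp
  ultimately show ?thesis unfolding tree_decomposition_iff using T' by blast
qed

text \<open>All cliques lie in the original graph, so the vertices of \<open>B\<close> can be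
  attached one at a time without disturbing each other. The strict bound on
  \<open>card (K b)\<close> leaves room for \<open>b\<close> in the new bag.\<close>

lemma tree_decomposition_attach_cliques:
  fixes T :: "nat pair_pre_digraph"
  assumes dec: "tree_decomposition G T X" and le: "\<And>t. t \<in> pverts T \<Longrightarrow> card (X t) \<le> m"
    and "finite B" "B \<inter> pverts G = {}"
    and clique: "\<And>b u v. b \<in> B \<Longrightarrow> u \<in> K b \<Longrightarrow> v \<in> K b \<Longrightarrow> u \<noteq> v \<Longrightarrow> (u, v) \<in> parcs G"
    and K: "\<And>b. b \<in> B \<Longrightarrow> K b \<noteq> {} \<and> K b \<subseteq> pverts G \<and> card (K b) < m"
  shows "\<exists>(T' :: nat pair_pre_digraph) X'.
    tree_decomposition \<lparr> pverts = pverts G \<union> B, parcs = parcs G \<union> Sigma B K \<union> (Sigma B K)\<inverse> \<rparr> T' X' \<and>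
    (\<forall>t\<in>pverts T'. card (X' t) \<le> m)"
  using assms(3-)
proof (induction B)
  case empty
  have "tree_decomposition \<lparr> pverts = pverts G, parcs = parcs G \<rparr> T X"
    by (rule tree_decomposition_mono[OF dec]) auto
  then show ?case using le by auto
next
  case (insert b B)
  let ?G = "\<lambda>B. \<lparr> pverts = pverts G \<union> B, parcs = parcs G \<union> Sigma B K \<union> (Sigma B K)\<inverse> \<rparr>"
  obtain T' :: "nat pair_pre_digraph" and X' where
    dec': "tree_decomposition (?G B) T' X'" and le': "\<forall>t\<in>pverts T'. card (X' t) \<le> m"
    using insert.IH insert.prems(1) insert.prems(2,3)[OF insertI2] by blast
  have Kb: "K b \<noteq> {}" "K b \<subseteq> pverts G" "card (K b) < m" using insert.prems(3)[of b] by auto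
  have cl: "(u, v) \<in> parcs (?G B)" if "u \<in> K b" "v \<in> K b" "u \<noteq> v" for u v
    using insert.prems(2)[OF insertI1 that] by simp
  have "K b \<subseteq> pverts (?G B)" using Kb(2) by auto
  then obtain t where t: "t \<in> pverts T'" "K b \<subseteq> X' t"
    using clique_in_bag[OF dec' Kb(1) _ cl] by blast
  have T': "pair_graph T'" using dec' unfolding tree_decomposition_iff by blast
  obtain s where s: "s \<notin> pverts T'"
    using pair_graph_finite[OF T'] ex_new_if_finite[OF infinite_UNIV_nat] by blast
  have b: "b \<notin> pverts (?G B)" using insert.hyps insert.prems(1) by auto
  have "tree_decomposition (?G (insert b B)) (attach s {t} T') (X'(s := insert b (K b)))"
    by (rule tree_decomposition_mono[OF tree_decomposition_attach[OF dec' t b s]]) auto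
  moreover have "card (insert b (K b)) \<le> m"
    using Kb(3) card_insert_le_m1[of m "K b" b] by linarith
  then have "\<forall>r\<in>pverts (attach s {t} T'). card ((X'(s := insert b (K b))) r) \<le> m"
    using le' by auto
  ultimately show ?case by blast
qed

lemma treewidth_le_card:
  assumes "pair_graph G"
  shows "treewidth G \<le> card (pverts G)"
proof -
  obtain T :: "nat pair_pre_digraph" and X where dec: "tree_decomposition G T X"
    using ex_tree_decomposition[OF assms] by blast
  have "card (X t) \<le> card (pverts G)" if "t \<in> pverts T" for t
    using dec that pair_graph_finite[OF assms] unfolding tree_decomposition_def
    by (intro card_mono) auto
  then show ?thesis using treewidth_le[OF dec, of "card (pverts G)"] by fastforce
qed

section \<open>Subsets of fixed size under permutations\<close>

lemma ksubsets_iff: "A \<in> ksubsets n k \<longleftrightarrow> A \<subseteq> {1..n} \<and> card A = k"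
  by (simp add: ksubsets_def)

lemma ksubsets_finite: "A \<in> ksubsets n k \<Longrightarrow> finite A"
  unfolding ksubsets_iff by (metis finite_atLeastAtMost finite_subset)

lemma card_ksubsets: "card (ksubsets n k) = n choose k"
  using n_subsets[of "{1..n}" k] by (simp add: ksubsets_def)

lemma permutes_image_ksubsets:
  assumes "\<sigma> permutes {1..n}" "A \<in> ksubsets n k"
  shows "\<sigma> ` A \<in> ksubsets n k"
proof -
  have "\<sigma> ` A \<subseteq> {1..n}" using assms permutes_image[OF assms(1)] unfolding ksubsets_iff by blast
  moreover have "card (\<sigma> ` A) = card A"
    using permutes_inj_on[OF assms(1)] by (rule card_image)
  ultimately show ?thesis using assms(2) unfolding ksubsets_iff by simp
qed

text \<open>Two bijections, \<open>A\<close> to \<open>B\<close> and complement to complement, are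
  glued and extended by the identity: the symmetric group is transitive on subsets of one
  size.\<close>

lemma ex_permutes_image_eq:
  assumes "finite S" "A \<subseteq> S" "B \<subseteq> S" "card A = card B"
  shows "\<exists>\<tau>. \<tau> permutes S \<and> \<tau> ` A = B"
proof -
  have fin: "finite A" "finite B" using assms finite_subset by blast+
  obtain f where f: "bij_betw f A B"
    using finite_same_card_bij[OF fin assms(4)] by blast
  have "card (S - A) = card (S - B)" using assms fin by (simp add: card_Diff_subset)
  then obtain g where g: "bij_betw g (S - A) (S - B)"
    using finite_same_card_bij[of "S - A" "S - B"] assms(1) by blast
  define \<tau> where "\<tau> x = (if x \<in> A then f x else if x \<in> S then g x else x)" for x
  have 1: "bij_betw \<tau> A B" using f by (rule bij_betw_cong[THEN iffD1, rotated]) (simp add: \<tau>_def)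
  have 2: "bij_betw \<tau> (S - A) (S - B)"
    using g by (rule bij_betw_cong[THEN iffD1, rotated]) (simp add: \<tau>_def)
  have "bij_betw \<tau> (A \<union> (S - A)) (B \<union> (S - B))" by (rule bij_betw_combine[OF 1 2]) blast
  moreover have "A \<union> (S - A) = S" "B \<union> (S - B) = S" using assms by blast+
  ultimately have "bij_betw \<tau> S S" by simp
  then have "\<tau> permutes S" by (rule bij_imp_permutes) (use assms in \<open>auto simp: \<tau>_def\<close>)
  then show ?thesis using 1 unfolding bij_betw_def by blast
qed

text \<open>A random permutation sends \<open>p\<close> to a uniform element of its layer: composing
  with a permutation that takes \<open>q\<close> to \<open>q'\<close> embeds the fibre over
  \<open>q\<close> into the one over \<open>q'\<close>, so all fibres have one size. The multiplied
  form avoids division.\<close>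

lemma card_permutes_image_in:
  assumes p: "p \<in> ksubsets n k"
  shows "card (ksubsets n k) * card {\<sigma>. \<sigma> permutes {1..n} \<and> \<sigma> ` p \<in> X}
    = fact n * card (X \<inter> ksubsets n k)"
proof -
  let ?K = "ksubsets n k"
  let ?C = "\<lambda>q. {\<sigma>. \<sigma> permutes {1..n} \<and> \<sigma> ` p = q}"
  have fin: "finite (?C q)" for q
    by (rule finite_subset[OF _ finite_permutations[of "{1..n}"]]) auto
  have le: "card (?C q) \<le> card (?C q')" if q: "q \<in> ?K" "q' \<in> ?K" for q q'
  proof -
    obtain \<tau> where \<tau>: "\<tau> permutes {1..n}" "\<tau> ` q = q'"
      using ex_permutes_image_eq[of "{1..n}" q q'] q unfolding ksubsets_iff by auto
    show ?thesis
    proof (rule card_inj_on_le)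
      show "inj_on (\<lambda>\<sigma>. \<tau> \<circ> \<sigma>) (?C q)"
        using fun.inj_map[OF permutes_inj[OF \<tau>(1)]] by (rule inj_on_subset) simp
      show "(\<lambda>\<sigma>. \<tau> \<circ> \<sigma>) ` ?C q \<subseteq> ?C q'"
        using \<tau> by (auto simp: permutes_compose image_comp[symmetric])
    qed (rule fin)
  qed
  have eq: "card (?C q) = card (?C p)" if "q \<in> ?K" for q
    using le[OF that p] le[OF p that] by simp
  have count: "card {\<sigma>. \<sigma> permutes {1..n} \<and> \<sigma> ` p \<in> Y} = card (Y \<inter> ?K) * card (?C p)" for Y
  proof -
    have "{\<sigma>. \<sigma> permutes {1..n} \<and> \<sigma> ` p \<in> Y} = (\<Union>q\<in>Y \<inter> ?K. ?C q)"
      using permutes_image_ksubsets[OF _ p] by blast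
    also have "card \<dots> = (\<Sum>q\<in>Y \<inter> ?K. card (?C q))"
      by (rule card_UN_disjoint) (use finite_ksubsets fin in auto)
    also have "\<dots> = (\<Sum>q\<in>Y \<inter> ?K. card (?C p))" by (rule sum.cong) (use eq in auto)
    finally show ?thesis by simp
  qed
  \<comment> \<open>With \<open>UNIV\<close> for \<open>Y\<close> every permutation is counted,
    which fixes the size of a fibre.\<close>
  have "fact n = card ?K * card (?C p)"
    using count[of UNIV] card_permutations[of "{1..n}" n] by simp
  then show ?thesis using count[of X] by simp
qed

lemma sum_card_swap:
  assumes "finite A" "finite B"
  shows "(\<Sum>a\<in>A. card {b \<in> B. R a b}) = (\<Sum>b\<in>B. card {a \<in> A. R a b})"
proof -
  have "(\<Sum>a\<in>A. card {b \<in> B. R a b}) = (\<Sum>a\<in>A. \<Sum>b\<in>B. if R a b then 1 else 0)"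
    by (rule sum.cong) (simp_all add: assms sum.If_cases Int_def)
  also have "\<dots> = (\<Sum>b\<in>B. \<Sum>a\<in>A. if R a b then 1 else 0)" by (rule sum.swap)
  also have "\<dots> = (\<Sum>b\<in>B. card {a \<in> A. R a b})"
    by (rule sum.cong) (simp_all add: assms sum.If_cases Int_def)
  finally show ?thesis .
qed

section \<open>Lower bound for the bipartite Kneser graph\<close>

lemma bipartite_kneser_simps:
  "pverts (bipartite_kneser (2 * k + 1) k) = ksubsets (2 * k + 1) k \<union> ksubsets (2 * k + 1) (k + 1)"
  "(A, B) \<in> parcs (bipartite_kneser (2 * k + 1) k) \<longleftrightarrow>
    A \<in> ksubsets (2 * k + 1) k \<and> B \<in> ksubsets (2 * k + 1) (k + 1) \<and> A \<subseteq> B \<or>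
    B \<in> ksubsets (2 * k + 1) k \<and> A \<in> ksubsets (2 * k + 1) (k + 1) \<and> B \<subseteq> A"
  by (auto simp: bipartite_kneser_def)

text \<open>
  \<open>P\<close> is the vertex set of a walk that exchanges the elements of \<open>A - A'\<close> one by one for
  those of \<open>A' - A\<close>.
\<close>

lemma exchange_path:
  fixes k :: nat
  defines "G \<equiv> bipartite_kneser (2 * k + 1) k"
  assumes "A \<in> ksubsets (2 * k + 1) k" "A' \<in> ksubsets (2 * k + 1) k"
  shows "\<exists>P. P \<subseteq> pverts G \<and> conn_on (parcs G) P \<and> A \<in> P \<and> A' \<in> P \<and>
    finite P \<and> card P \<le> 2 * card (A' - A) + 1"
  using assms(2,3)
proof (induction "card (A' - A)" arbitrary: A)
  case 0
  have fin: "finite A" "finite A'" using 0 ksubsets_finite by blast+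
  have "A' \<subseteq> A" using 0(1) fin by simp
  then have "A' = A" using 0(2,3) fin unfolding ksubsets_iff by (metis card_subset_eq)
  moreover have "A \<in> pverts G" using 0(2) unfolding G_def bipartite_kneser_simps by blast
  ultimately show ?case by (intro exI[of _ "{A}"]) (simp add: conn_on_singleton)
next
  case (Suc m)
  let ?n = "2 * k + 1"
  have fin: "finite A" "finite A'" using Suc.prems ksubsets_finite by blast+
  have sub: "A \<subseteq> {1..?n}" "card A = k" "A' \<subseteq> {1..?n}" "card A' = k"
    using Suc.prems unfolding ksubsets_iff by auto
  have "A' - A \<noteq> {}" using Suc.hyps(2) by (metis card.empty nat.distinct(1))
  then obtain b where b: "b \<in> A'" "b \<notin> A" by blast
  have "\<not> A \<subseteq> A'" using card_subset_eq[OF fin(2), of A] sub b by auto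
  then obtain a where a: "a \<in> A" "a \<notin> A'" by blast
  define A1 where "A1 = insert b A - {a}"
  have "card (insert b A) = k + 1" using fin b sub by simp
  then have B: "insert b A \<in> ksubsets ?n (k + 1)" using sub b unfolding ksubsets_iff by auto
  have "card A1 = k" unfolding A1_def using fin a \<open>card (insert b A) = k + 1\<close> by simp
  then have A1: "A1 \<in> ksubsets ?n k" using B unfolding ksubsets_iff A1_def by auto
  have "A' - A1 = (A' - A) - {b}" using a b unfolding A1_def by blast
  then have "m = card (A' - A1)" using Suc.hyps(2) b fin by simp
  then obtain P where P: "P \<subseteq> pverts G" "conn_on (parcs G) P" "A1 \<in> P" "A' \<in> P"
    "finite P" "card P \<le> 2 * card (A' - A1) + 1"
    using Suc.hyps(1)[OF _ A1 Suc.prems(2)] by blast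
  have "pair_graph G" unfolding G_def by (rule pair_graph_bipartite_kneser) simp
  then have symG: "sym (parcs G)" by (rule pair_graph_sym)
  have e1: "(insert b A, A1) \<in> parcs G" and e2: "(A, insert b A) \<in> parcs G"
    unfolding G_def bipartite_kneser_simps using A1 B Suc.prems(1) by (auto simp: A1_def)
  have "conn_on (parcs G) (insert (insert b A) P)"
    by (rule conn_on_insert[OF P(2,3) e1 _ symG]) (use e1 symG in \<open>blast dest: symD\<close>)
  then have "conn_on (parcs G) (insert A (insert (insert b A) P))"
    by (rule conn_on_insert[OF _ _ e2 _ symG]) (use e2 symG in \<open>blast dest: symD\<close>)+
  \<comment> \<open>Each exchange adds two vertices, \<open>A\<close> and the (k + 1)-set
    \<open>insert b A\<close>, hence the factor 2.\<close>
  moreover have "card (insert A (insert (insert b A) P)) \<le> 2 * Suc m + 1"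
    using P(6) \<open>m = card (A' - A1)\<close> card_insert_le_m1[of "2 * m + 2" P "insert b A"]
      card_insert_le_m1[of "2 * m + 3" "insert (insert b A) P" A] by simp
  moreover have "insert A (insert (insert b A) P) \<subseteq> pverts G"
    using P(1) B Suc.prems(1) unfolding G_def bipartite_kneser_simps by blast
  ultimately show ?case using P(4,5) Suc.hyps(2)
    by (intro exI[of _ "insert A (insert (insert b A) P)"]) auto
qed

text \<open>Double counting of the permutations \<sigma> and pairs z such that X separates the image
  of z under \<sigma>. For fixed \<sigma> their number is always \<open>bad\<close>; for fixed z it
  is bounded through a path. So fewer than half of all pairs are separated, and some
  \<open>A\<close> does at least as well as the average.\<close>

lemma majority_reachable:
  fixes k :: nat
  defines "G \<equiv> bipartite_kneser (2 * k + 1) k" and "K \<equiv> ksubsets (2 * k + 1) k"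
  assumes "finite X" and small: "2 * (2 * k + 1) * card X < card K"
  shows "\<exists>A\<in>K. 2 * card {A' \<in> K. \<not> (\<exists>P. P \<subseteq> pverts G - X \<and> conn_on (parcs G) P \<and> A \<in> P \<and> A' \<in> P)}
    < card K"
proof -
  let ?n = "2 * k + 1"
  let ?reach = "\<lambda>A A'. \<exists>P. P \<subseteq> pverts G - X \<and> conn_on (parcs G) P \<and> A \<in> P \<and> A' \<in> P"
  let ?S = "{\<sigma>. \<sigma> permutes {1..?n}}"
  let ?R = "\<lambda>\<sigma> z. \<not> ?reach (\<sigma> ` fst z) (\<sigma> ` snd z)"
  define bad where "bad = card {z \<in> K \<times> K. \<not> ?reach (fst z) (snd z)}"
  have finK: "finite K" unfolding K_def by (rule finite_ksubsets)
  have finS: "finite ?S" by (rule finite_permutations) simp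
  have layer: "card (ksubsets ?n (k + 1)) = card K"
    unfolding K_def card_ksubsets using binomial_symmetric[of "k + 1" ?n] by simp
  \<comment> \<open>By uniformity at most a fraction card X / card K of the permutations moves
    \<open>p\<close> into \<open>X\<close>; \<open>layer\<close> makes this one bound for both
    layers.\<close>
  have hit: "card K * card {\<sigma> \<in> ?S. \<sigma> ` p \<in> X} \<le> fact ?n * card X" if p: "p \<in> pverts G" for p
  proof -
    obtain j where j: "p \<in> ksubsets ?n j" "card (ksubsets ?n j) = card K"
      using p layer unfolding G_def bipartite_kneser_simps K_def by blast
    have "card (X \<inter> ksubsets ?n j) \<le> card X" using assms(3) by (intro card_mono) auto
    then show ?thesis using card_permutes_image_in[OF j(1), of X] j(2) by simp
  qed
  have bad_z: "card K * card {\<sigma> \<in> ?S. ?R \<sigma> z} \<le> ?n * (fact ?n * card X)" if z: "z \<in> K \<times> K" for z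
  proof -
    obtain P where P: "P \<subseteq> pverts G" "conn_on (parcs G) P" "fst z \<in> P" "snd z \<in> P" "finite P"
      "card P \<le> 2 * card (snd z - fst z) + 1"
      using exchange_path[of "fst z" k "snd z"] z unfolding G_def K_def by auto
    have snd_z: "snd z \<in> ksubsets ?n k" using z unfolding K_def mem_Times_iff by blast
    \<comment> \<open>At most k exchanges are made, so the path has at most 2k + 1 vertices, the
      factor of the union bound below.\<close>
    have "card (snd z - fst z) \<le> card (snd z)"
      using ksubsets_finite[OF snd_z] by (rule card_mono) blast
    also have "card (snd z) = k" using snd_z unfolding ksubsets_iff by blast
    finally have "card (snd z - fst z) \<le> k" .
    then have cP: "card P \<le> ?n" using P(6) by simp
    \<comment> \<open>If \<open>\<sigma>\<close> moves all of \<open>P\<close> away from \<open>X\<close>, the image of \<open>P\<close> joins the images of the end points.\<close>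
    have "{\<sigma> \<in> ?S. ?R \<sigma> z} \<subseteq> (\<Union>p\<in>P. {\<sigma> \<in> ?S. \<sigma> ` p \<in> X})"
    proof
      fix \<sigma> assume \<sigma>: "\<sigma> \<in> {\<sigma> \<in> ?S. ?R \<sigma> z}"
      show "\<sigma> \<in> (\<Union>p\<in>P. {\<sigma> \<in> ?S. \<sigma> ` p \<in> X})"
      proof (rule ccontr)
        assume "\<not> ?thesis"
        then have notX: "\<sigma> ` p \<notin> X" if "p \<in> P" for p using \<sigma> that by blast
        have perm: "\<sigma> permutes {1..?n}" using \<sigma> by blast
        have "conn_on (parcs G) ((`) \<sigma> ` P)"
        proof (rule conn_on_image[OF P(2)])
          fix x y assume "(x, y) \<in> parcs G"
          then show "(\<sigma> ` x, \<sigma> ` y) \<in> parcs G"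
            unfolding G_def bipartite_kneser_simps
            using permutes_image_ksubsets[OF perm] image_mono by metis
        qed
        moreover have "(`) \<sigma> ` P \<subseteq> pverts G - X"
          using notX P(1) permutes_image_ksubsets[OF perm]
          unfolding G_def bipartite_kneser_simps by blast
        ultimately have "?reach (\<sigma> ` fst z) (\<sigma> ` snd z)"
          using P(3,4) by blast
        then show False using \<sigma> by blast
      qed
    qed
    then have "card {\<sigma> \<in> ?S. ?R \<sigma> z} \<le> card (\<Union>p\<in>P. {\<sigma> \<in> ?S. \<sigma> ` p \<in> X})"
      by (rule card_mono[rotated]) (use P(5) finS in auto)
    also have "\<dots> \<le> (\<Sum>p\<in>P. card {\<sigma> \<in> ?S. \<sigma> ` p \<in> X})" by (rule card_UN_le[OF P(5)])
    finally have "card K * card {\<sigma> \<in> ?S. ?R \<sigma> z} \<le> (\<Sum>p\<in>P. card K * card {\<sigma> \<in> ?S. \<sigma> ` p \<in> X})"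
      unfolding sum_distrib_left[symmetric] by (rule mult_left_mono) simp
    also have "\<dots> \<le> (\<Sum>p\<in>P. fact ?n * card X)" by (rule sum_mono) (use hit P(1) in blast)
    also have "\<dots> \<le> ?n * (fact ?n * card X)"
      unfolding sum_constant of_nat_id by (rule mult_right_mono[OF cP]) simp
    finally show ?thesis .
  qed
  \<comment> \<open>A permutation acts bijectively on \<open>K \<times> K\<close>, so it merely
    rearranges the separated pairs.\<close>
  have bad_\<sigma>: "card {z \<in> K \<times> K. ?R \<sigma> z} = bad" if "\<sigma> \<in> ?S" for \<sigma>
  proof -
    have perm: "\<sigma> permutes {1..?n}" using that by blast
    have "inj_on ((`) \<sigma>) K" using permutes_inj[OF perm] by (auto intro!: inj_onI simp: inj_image_eq_iff)
    moreover have "(`) \<sigma> ` K \<subseteq> K" using permutes_image_ksubsets[OF perm] unfolding K_def by blast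
    ultimately have bij: "bij_betw ((`) \<sigma>) K K"
      using endo_inj_surj[OF finK] unfolding bij_betw_def by blast
    have "bij_betw (map_prod ((`) \<sigma>) ((`) \<sigma>)) (K \<times> K) (K \<times> K)"
      by (rule bij_betw_map_prod[OF bij bij])
    then have "bij_betw (map_prod ((`) \<sigma>) ((`) \<sigma>)) {z \<in> K \<times> K. ?R \<sigma> z}
        {z \<in> K \<times> K. \<not> ?reach (fst z) (snd z)}"
      by (rule bij_betw_Collect) simp
    then show ?thesis unfolding bad_def by (rule bij_betw_same_card)
  qed
  have "fact ?n * bad = (\<Sum>\<sigma>\<in>?S. card {z \<in> K \<times> K. ?R \<sigma> z})"
    using bad_\<sigma> card_permutations[of "{1..?n}" ?n] by simp
  also have "\<dots> = (\<Sum>z\<in>K \<times> K. card {\<sigma> \<in> ?S. ?R \<sigma> z})"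
    by (rule sum_card_swap) (use finS finK in auto)
  finally have "card K * (fact ?n * bad) = (\<Sum>z\<in>K \<times> K. card K * card {\<sigma> \<in> ?S. ?R \<sigma> z})"
    by (simp only: sum_distrib_left)
  also have "\<dots> \<le> (\<Sum>z\<in>K \<times> K. ?n * (fact ?n * card X))" by (rule sum_mono) (rule bad_z)
  also have "\<dots> = card K * (fact ?n * (card K * (?n * card X)))"
    by (simp only: sum_constant card_cartesian_product of_nat_id mult.assoc mult.left_commute)
  finally have le: "card K * (fact ?n * bad) \<le> card K * (fact ?n * (card K * (?n * card X)))" .
  have pos: "0 < card K" using small by linarith
  then have "bad \<le> card K * (?n * card X)"
    using le fact_gt_zero[of ?n] unfolding nat_mult_le_cancel_disj by blast
  then have "2 * bad \<le> 2 * (card K * (?n * card X))" by (rule mult_left_mono) simp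
  also have "\<dots> = card K * (2 * ?n * card X)" by (simp only: mult.assoc mult.left_commute)
  also have "\<dots> < card K * card K" using small pos by (rule mult_strict_left_mono)
  finally have bad_lt: "2 * bad < card K * card K" .
  show ?thesis
  proof (rule ccontr)
    assume "\<not> ?thesis"
    then have ge: "card K \<le> 2 * card {A' \<in> K. \<not> ?reach A A'}" if "A \<in> K" for A
      using that not_less by blast
    have "{z \<in> K \<times> K. \<not> ?reach (fst z) (snd z)} = Sigma K (\<lambda>A. {A' \<in> K. \<not> ?reach A A'})" by auto
    then have "bad = (\<Sum>A\<in>K. card {A' \<in> K. \<not> ?reach A A'})"
      unfolding bad_def using finK by (simp only:) (rule card_SigmaI, simp_all)
    then have "2 * bad = (\<Sum>A\<in>K. 2 * card {A' \<in> K. \<not> ?reach A A'})"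
      by (simp only: sum_distrib_left)
    also have "\<dots> \<ge> (\<Sum>A\<in>K. card K)" by (rule sum_mono) (rule ge)
    finally show False using bad_lt by simp
  qed
qed

lemma Int_nonempty_of_card_gt:
  assumes "finite K" "S \<subseteq> K" "S' \<subseteq> K" "card K < 2 * card S" "card K < 2 * card S'"
  shows "S \<inter> S' \<noteq> {}"
proof
  assume "S \<inter> S' = {}"
  then have "card S + card S' = card (S \<union> S')"
    using assms finite_subset by (metis card_Un_disjoint)
  also have "\<dots> \<le> card K" using assms by (intro card_mono) auto
  finally show False using assms by simp
qed

lemma bipartite_kneser_treewidth_ge:
  "(2 * k + 1) choose k \<le> 2 * (2 * k + 1) * (treewidth (bipartite_kneser (2 * k + 1) k) + 1)"
proof (rule ccontr)
  let ?G = "bipartite_kneser (2 * k + 1) k" and ?K = "ksubsets (2 * k + 1) k"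
  assume "\<not> ?thesis"
  then have small: "2 * (2 * k + 1) * (treewidth ?G + 1) < card ?K"
    by (simp only: card_ksubsets not_le)
  have pg: "pair_graph ?G" by (rule pair_graph_bipartite_kneser) simp
  have finV: "finite (pverts ?G)" using pair_graph_finite[OF pg] .
  have symG: "sym (parcs ?G)" using pair_graph_sym[OF pg] .
  have finK: "finite ?K" by (rule finite_ksubsets)
  obtain T :: "nat pair_pre_digraph" and X where dec: "tree_decomposition ?G T X"
    and le: "\<And>t. t \<in> pverts T \<Longrightarrow> card (X t) \<le> treewidth ?G + 1"
    using optimal_tree_decomposition[OF pg] by blast
  have T: "conn_on (parcs T) (pverts T)" and cover: "(\<Union>t\<in>pverts T. X t) = pverts ?G"
    using dec unfolding tree_decomposition_iff by blast+
  have ex: "\<exists>C. C \<subseteq> pverts ?G - X t \<and> conn_on (parcs ?G) C \<and> card ?K < 2 * card (C \<inter> ?K)"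
    if t: "t \<in> pverts T" for t
  proof -
    have "X t \<subseteq> pverts ?G" using cover t by blast
    then have "finite (X t)" using finV finite_subset by blast
    moreover have "2 * (2 * k + 1) * card (X t) \<le> 2 * (2 * k + 1) * (treewidth ?G + 1)"
      using le[OF t] by (rule mult_left_mono) simp
    then have "2 * (2 * k + 1) * card (X t) < card ?K" using small by (rule le_less_trans)
    ultimately obtain A where A: "2 * card {A' \<in> ?K. \<not> (\<exists>P. P \<subseteq> pverts ?G - X t \<and>
        conn_on (parcs ?G) P \<and> A \<in> P \<and> A' \<in> P)} < card ?K"
      using majority_reachable by blast
    \<comment> \<open>The union of all connected sets through \<open>A\<close> that avoid the bag is
      the component of \<open>A\<close>; it misses only k-subsets that were counted in the choice of
      \<open>A\<close>.\<close>
    define \<P> where "\<P> = {P. P \<subseteq> pverts ?G - X t \<and> conn_on (parcs ?G) P \<and> A \<in> P}"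
    have "?K - \<Union>\<P> \<subseteq> {A' \<in> ?K. \<not> (\<exists>P. P \<subseteq> pverts ?G - X t \<and>
        conn_on (parcs ?G) P \<and> A \<in> P \<and> A' \<in> P)}"
      unfolding \<P>_def by blast
    then have "card (?K - \<Union>\<P>) \<le> card {A' \<in> ?K. \<not> (\<exists>P. P \<subseteq> pverts ?G - X t \<and>
        conn_on (parcs ?G) P \<and> A \<in> P \<and> A' \<in> P)}"
      using finK by (intro card_mono) auto
    then have "2 * card (?K - \<Union>\<P>) < card ?K" using A by linarith
    moreover have "card ?K = card (?K \<inter> \<Union>\<P>) + card (?K - \<Union>\<P>)"
      using card_Int_Diff[OF finK] .
    ultimately have big: "card ?K < 2 * card (\<Union>\<P> \<inter> ?K)"
      unfolding Int_commute[of "\<Union>\<P>"] by linarith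
    then have "\<P> \<noteq> {}" by (metis Int_empty_left Sup_empty card.empty mult_0_right not_less0)
    then have "conn_on (parcs ?G) (\<Union>\<P>)"
      using conn_on_Union[of \<P> "parcs ?G" A] symG unfolding \<P>_def by blast
    moreover have "\<Union>\<P> \<subseteq> pverts ?G - X t" unfolding \<P>_def by blast
    ultimately show ?thesis using big by blast
  qed
  obtain C where C: "\<forall>t\<in>pverts T. C t \<subseteq> pverts ?G - X t \<and> conn_on (parcs ?G) (C t) \<and>
      card ?K < 2 * card (C t \<inter> ?K)"
    using bchoice[OF ballI[OF ex]] by (rule exE)
  have "\<exists>x\<in>S. \<exists>y\<in>S'. x = y \<or> (x, y) \<in> parcs ?G" if "S \<in> C ` pverts T" "S' \<in> C ` pverts T" for S S'
  proof -
    have "(S \<inter> ?K) \<inter> (S' \<inter> ?K) \<noteq> {}"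
      using Int_nonempty_of_card_gt[OF finK, of "S \<inter> ?K" "S' \<inter> ?K"] C that by blast
    then show ?thesis by blast
  qed
  moreover have "C ` pverts T \<noteq> {}" using T unfolding conn_on_def by blast
  moreover have "conn_on (parcs ?G) S \<and> S \<subseteq> pverts ?G" if "S \<in> C ` pverts T" for S
    using C that by blast
  ultimately obtain t where "t \<in> pverts T" "\<And>S. S \<in> C ` pverts T \<Longrightarrow> X t \<inter> S \<noteq> {}"
    using bramble_hit_by_bag[OF dec] by metis
  then show False using C by blast
qed

section \<open>Comparison with the Johnson graph, and the constants\<close>

lemma treewidth_ge_clique:
  assumes "pair_graph G" "K \<noteq> {}" "K \<subseteq> pverts G"
    and "\<And>u v. u \<in> K \<Longrightarrow> v \<in> K \<Longrightarrow> u \<noteq> v \<Longrightarrow> (u, v) \<in> parcs G"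
  shows "card K \<le> treewidth G + 1"
proof -
  obtain T :: "nat pair_pre_digraph" and X where dec: "tree_decomposition G T X"
    and le: "\<And>t. t \<in> pverts T \<Longrightarrow> card (X t) \<le> treewidth G + 1"
    using optimal_tree_decomposition[OF assms(1)] by blast
  obtain t where t: "t \<in> pverts T" "K \<subseteq> X t" using clique_in_bag[OF dec assms(2-4)] by blast
  have "X t \<subseteq> pverts G" using dec t(1) unfolding tree_decomposition_def by blast
  then have "finite (X t)" using pair_graph_finite[OF assms(1)] finite_subset by blast
  then show ?thesis using card_mono[OF _ t(2)] le[OF t(1)] by linarith
qed

text \<open>An edge is a clique with two vertices. The bound lets the treewidth plus 1 be replaced
  by twice the treewidth in the final estimate.\<close>

lemma bipartite_kneser_treewidth_pos: "1 \<le> treewidth (bipartite_kneser (2 * k + 1) k)"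
proof -
  let ?G = "bipartite_kneser (2 * k + 1) k"
  have A: "{1..k} \<in> ksubsets (2 * k + 1) k" and B: "{1..k + 1} \<in> ksubsets (2 * k + 1) (k + 1)"
    by (auto simp: ksubsets_iff)
  have pg: "pair_graph ?G" by (rule pair_graph_bipartite_kneser) simp
  have e: "({1..k}, {1..k + 1}) \<in> parcs ?G" "({1..k + 1}, {1..k}) \<in> parcs ?G"
    unfolding bipartite_kneser_simps using A B by auto
  have "card {{1..k}, {1..k + 1}} \<le> treewidth ?G + 1"
  proof (rule treewidth_ge_clique[OF pg])
    show "{{1..k}, {1..k + 1}} \<subseteq> pverts ?G" unfolding bipartite_kneser_simps using A B by blast
  qed (use e in blast)+
  moreover have "{1..k} \<noteq> {1..k + 1}" by (metis add_right_cancel card_atLeastAtMost diff_add_inverse2 n_not_Suc_n Suc_eq_plus1)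
  ultimately show ?thesis by simp
qed

lemma johnson_simps:
  "pverts (johnson n k) = ksubsets n k"
  "(A, B) \<in> parcs (johnson n k) \<longleftrightarrow> A \<in> ksubsets n k \<and> B \<in> ksubsets n k \<and> card (A \<inter> B) + 1 = k"
  by (auto simp: johnson_def)

text \<open>The clique consists of the k-subsets containing \<open>{1..k - 1}\<close>, one for each
  of k + 2 further elements. The other natural clique, the k-subsets of a (k + 1)-set, has one
  vertex fewer, too few to absorb the bags of size k + 2.\<close>

lemma johnson_treewidth_ge:
  assumes "0 < k"
  shows "k + 1 \<le> treewidth (johnson (2 * k + 1) k)"
proof -
  let ?G = "johnson (2 * k + 1) k" and ?f = "\<lambda>x. insert x {1..k - 1}"
  have mem: "?f x \<in> ksubsets (2 * k + 1) k" if "x \<in> {k..2 * k + 1}" for x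
    using that assms by (auto simp: ksubsets_iff)
  have "inj_on ?f {k..2 * k + 1}"
  proof (rule inj_onI)
    fix x y assume "x \<in> {k..2 * k + 1}" "y \<in> {k..2 * k + 1}" "?f x = ?f y"
    then show "x = y" using assms by (metis atLeastAtMost_iff diff_less insertE insertI1 leD le_trans less_numeral_extra(1))
  qed
  then have "card (?f ` {k..2 * k + 1}) = k + 2" using card_image by fastforce
  moreover have "card (?f ` {k..2 * k + 1}) \<le> treewidth ?G + 1"
  proof (rule treewidth_ge_clique[OF pair_graph_johnson])
    show "?f ` {k..2 * k + 1} \<subseteq> pverts ?G" unfolding johnson_simps using mem by blast
    show "?f ` {k..2 * k + 1} \<noteq> {}" by simp
  next
    fix u v assume "u \<in> ?f ` {k..2 * k + 1}" "v \<in> ?f ` {k..2 * k + 1}" and ne: "u \<noteq> v"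
    then obtain x y where xy: "x \<in> {k..2 * k + 1}" "u = ?f x" "y \<in> {k..2 * k + 1}" "v = ?f y"
      by blast
    then have "u \<inter> v = {1..k - 1}" using ne by auto
    then have "card (u \<inter> v) + 1 = k" using assms by simp
    moreover have "u \<in> ksubsets (2 * k + 1) k" "v \<in> ksubsets (2 * k + 1) k"
      unfolding xy(2,4) using mem xy(1,3) by blast+
    ultimately show "(u, v) \<in> parcs ?G" unfolding johnson_simps by blast
  qed
  ultimately show ?thesis by simp
qed

text \<open>The comparison goes through the Johnson graph enlarged by the second layer; the edges
  among k-subsets are dropped at the end. For k = 0 the inequality fails: a single edge against a
  single vertex.\<close>

lemma bipartite_kneser_treewidth_le_johnson:
  assumes "0 < k"
  shows "treewidth (bipartite_kneser (2 * k + 1) k) \<le> treewidth (johnson (2 * k + 1) k)"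
proof -
  let ?n = "2 * k + 1"
  let ?G = "bipartite_kneser ?n k" and ?J = "johnson ?n k" and ?B = "ksubsets ?n (k + 1)"
  let ?sub = "\<lambda>B. {A \<in> ksubsets ?n k. A \<subseteq> B}"
  obtain T :: "nat pair_pre_digraph" and X where dec: "tree_decomposition ?J T X"
    and le: "\<And>t. t \<in> pverts T \<Longrightarrow> card (X t) \<le> treewidth ?J + 1"
    using optimal_tree_decomposition[OF pair_graph_johnson] by blast
  have "\<exists>(T' :: nat pair_pre_digraph) X'. tree_decomposition \<lparr> pverts = pverts ?J \<union> ?B,
      parcs = parcs ?J \<union> Sigma ?B ?sub \<union> (Sigma ?B ?sub)\<inverse> \<rparr> T' X' \<and>
    (\<forall>t\<in>pverts T'. card (X' t) \<le> treewidth ?J + 1)"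
  proof (rule tree_decomposition_attach_cliques[OF dec le])
    show "finite ?B" by (rule finite_ksubsets)
    show "?B \<inter> pverts ?J = {}" unfolding johnson_simps by (auto simp: ksubsets_iff)
  next
    fix b u v assume b: "b \<in> ?B" and u: "u \<in> ?sub b" and v: "v \<in> ?sub b" and ne: "u \<noteq> v"
    have fin: "finite b" "finite u" "finite v" using b u v ksubsets_finite by blast+
    have c: "card b = k + 1" "card u = k" "card v = k" using b u v by (auto simp: ksubsets_iff)
    \<comment> \<open>Two distinct k-subsets of \<open>b\<close> together fill its k + 1 elements,
      so they share k - 1 of them.\<close>
    have "\<not> v \<subseteq> u" using card_subset_eq[OF fin(2), of v] c ne by auto
    then have "card u < card (u \<union> v)" using fin by (intro psubset_card_mono) auto
    moreover have "card (u \<union> v) \<le> card b" using fin u v by (intro card_mono) auto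
    ultimately have "card (u \<union> v) = k + 1" using c by simp
    then have "card (u \<inter> v) + 1 = k" using card_Un_Int[OF fin(2,3)] c by simp
    then show "(u, v) \<in> parcs ?J" unfolding johnson_simps using u v by blast
  next
    fix b assume b: "b \<in> ?B"
    have "?sub b = {A. A \<subseteq> b \<and> card A = k}" using b unfolding ksubsets_def by blast
    then have "card (?sub b) = (k + 1) choose k"
      using n_subsets[OF ksubsets_finite[OF b], of k] b by (simp add: ksubsets_iff)
    then have "card (?sub b) = k + 1" by simp
    moreover from this have "?sub b \<noteq> {}" by (metis add_is_0 card.empty one_neq_zero)
    ultimately show "?sub b \<noteq> {} \<and> ?sub b \<subseteq> pverts ?J \<and> card (?sub b) < treewidth ?J + 1"
      unfolding johnson_simps using johnson_treewidth_ge[OF assms] by auto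
  qed
  then obtain T' :: "nat pair_pre_digraph" and X' where
    dec': "tree_decomposition \<lparr> pverts = pverts ?J \<union> ?B,
      parcs = parcs ?J \<union> Sigma ?B ?sub \<union> (Sigma ?B ?sub)\<inverse> \<rparr> T' X'"
    and le': "\<forall>t\<in>pverts T'. card (X' t) \<le> treewidth ?J + 1" by blast
  have "tree_decomposition ?G T' X'"
  proof (rule tree_decomposition_mono[OF dec'])
    show "pverts ?G = pverts \<lparr> pverts = pverts ?J \<union> ?B,
      parcs = parcs ?J \<union> Sigma ?B ?sub \<union> (Sigma ?B ?sub)\<inverse> \<rparr>"
      by (simp only: johnson_simps bipartite_kneser_simps pair_pre_digraph.simps)
    show "parcs ?G \<subseteq> parcs \<lparr> pverts = pverts ?J \<union> ?B,
      parcs = parcs ?J \<union> Sigma ?B ?sub \<union> (Sigma ?B ?sub)\<inverse> \<rparr>"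
    proof (rule subrelI)
      fix A B assume "(A, B) \<in> parcs ?G"
      then show "(A, B) \<in> parcs \<lparr> pverts = pverts ?J \<union> ?B,
          parcs = parcs ?J \<union> Sigma ?B ?sub \<union> (Sigma ?B ?sub)\<inverse> \<rparr>"
        unfolding bipartite_kneser_simps by auto
    qed
  qed
  then show ?thesis using le' by (intro treewidth_le) auto
qed

theorem theorem1p4:
  shows "\<exists>c1 c2 :: real. 0 < c1 \<and> 0 < c2 \<and>
    (\<forall>k :: nat. 0 < k \<longrightarrow>
      c1 * (1 / real k) * real ((2 * k + 1) choose k)
        \<le> real (treewidth (bipartite_kneser (2 * k + 1) k)) \<and>
      treewidth (bipartite_kneser (2 * k + 1) k) \<le> treewidth (johnson (2 * k + 1) k) \<and>
      real (treewidth (johnson (2 * k + 1) k)) \<le> c2 * real ((2 * k + 1) choose k))"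
proof (intro exI conjI allI impI)
  \<comment> \<open>The 12 is 6 times 2: for positive k, 2(2k + 1) is at most 6k, and w + 1 is at
    most 2w for the treewidth w of the Kneser graph.\<close>
  show "(0 :: real) < 1 / 12" "(0 :: real) < 1" by simp_all
next
  fix k :: nat assume k: "0 < k"
  let ?w = "treewidth (bipartite_kneser (2 * k + 1) k)"
  have "(2 * k + 1) choose k \<le> 2 * (2 * k + 1) * (?w + 1)"
    by (rule bipartite_kneser_treewidth_ge)
  also have "\<dots> \<le> (2 * (3 * k)) * (2 * ?w)"
    using k bipartite_kneser_treewidth_pos[of k] by (intro mult_mono) auto
  finally have "real ((2 * k + 1) choose k) \<le> real ((2 * (3 * k)) * (2 * ?w))"
    by (rule of_nat_mono)
  then show "1 / 12 * (1 / real k) * real ((2 * k + 1) choose k) \<le> real ?w"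
    using k by (simp add: field_simps)
next
  fix k :: nat assume "0 < k"
  then show "treewidth (bipartite_kneser (2 * k + 1) k) \<le> treewidth (johnson (2 * k + 1) k)"
    by (rule bipartite_kneser_treewidth_le_johnson)
next
  fix k :: nat
  \<comment> \<open>Bags contain k-subsets only, so the number of vertices bounds the width; this
    gives \<open>c2 = 1\<close>.\<close>
  have "treewidth (johnson (2 * k + 1) k) \<le> (2 * k + 1) choose k"
    using treewidth_le_card[OF pair_graph_johnson, of "2 * k + 1" k]
    by (simp only: johnson_simps card_ksubsets)
  then show "real (treewidth (johnson (2 * k + 1) k)) \<le> 1 * real ((2 * k + 1) choose k)"
    by (simp only: mult_1 of_nat_le_iff)
qed

end
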